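(* Let $\Theta$ be a function class, $\hat\theta_h(x_0)$ an estimator of $\theta(x_0)$, $\theta\in\Theta$, with tuning parameter $h$, and suppose conditions (A1) and (A2) of the context hold, with $q(z)=(1-z^2)\phi(z)$ and $t=\sup_{\theta\in\Theta}|b_0(\theta)/\sigma_n(h)|$. For $\alpha\in(0,1)$ let $\operatorname{cv}_{1-\alpha}(t)$ be the upper $\alpha$-quantile (i.e. the $(1-\alpha)$-quantile) of the folded normal distribution $|\mathcal N(t,1)|$, let $$\mathrm{FLCI}(\alpha)=\big[\hat\theta_h(x_0)-\sigma_n(h)\operatorname{cv}_{1-\alpha}(t),\ \hat\theta_h(x_0)+\sigma_n(h)\operatorname{cv}_{1-\alpha}(t)\big],$$ and $\triangle_\alpha(t)=q(\operatorname{cv}_{1-\alpha}(t)-t)-q(\operatorname{cv}_{1-\alpha}(t)+t)$. Then, as $n\to\infty$, $$\inf_{\theta\in\Theta}\mathbb P_\theta\big(\theta(x_0)\in\mathrm{FLCI}(\alpha)\big)\le1-\alpha-\frac{|\kappa_{3,n}|}6|\triangle_\alpha(t)|+o(|\kappa_{3,n}|).$$ Furthermore, if $\theta_0\in\Theta$ satisfies $\Big|\frac{\mathbb E[\hat\theta_h(x_0)]-\theta_0(x_0)}{\sigma_n(h)}\Big|=t$ and $\operatorname{sgn}\Big(\frac{\mathbb E[\hat\theta_h(x_0)]-\theta_0(x_0)}{\sigma_n(h)}\Big)\kappa_{3,n}\triangle_\alpha(t)<0$ (expectation under $\theta_0$), then (A1) implies $$\mathbb P_{\theta_0}\big(\t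heta_0(x_0)\in\mathrm{FLCI}(\alpha)\big)\le1-\alpha-\frac{|\kappa_{3,n}|}6|\triangle_\alpha(t)|+o(|\kappa_{3,n}|).$$
   Context: Conditions: (A1) There exists a known deterministic factor $\sigma_n(h)>0$ such that $$\mathbb P\Big(\frac{\hat\theta_h(x_0)-\mathbb E[\hat\theta_h(x_0)]}{\sigma_n(h)}\le z\Big)=\Phi(z)+\frac{\kappa_{3,n}}6q(z)+r_n(z),\qquad q(z)=(1-z^2)\phi(z),$$ where $\Phi,\phi$ are the standard normal distribution function and density and, for every given $z$, $\lim_{n\to\infty}|r_n(z)/\kappa_{3,n}|=0$. (The representation, with the same $\kappa_{3,n}$ and $r_n$, is for the standardized estimator under the law of the data for the true $\theta\in\Theta$.) (A2) Let $b_0(\theta)=\mathbb E_\theta[\hat\theta_h(x_0)]-\theta(x_0)$ be the estimation bias and $t:=\sup_{\theta\in\Theta}|b_0(\theta)/\sigma_n(h)|$. For each $s\in\{-1,1\}$ there exists $\theta_s\in\Theta$ with $b_0(\theta_s)/\sigma_n(h)=st$. Here $t$ is treated as a fixed number not varying with $n$.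
   Formalization: Added hypothesis: for each θ in Θ and each fixed z, the probability that the standardized estimator equals z is o(κ_{3,n}); without it, (A1) does not control the atom at the left end point of the closed interval and both bounds can fail. *)

theory Defs
  imports "HOL-Probability.Probability" "HOL-Library.Landau_Symbols"
begin

definition q_fun :: "real \<Rightarrow> real" where
  "q_fun z = (1 - z\<^sup>2) * std_normal_density z"

(* Lower quantile; Inf is the genuine infimum for 0 < p < 1, the set being then
   nonempty and bounded below. *)
definition quantile :: "real measure \<Rightarrow> real \<Rightarrow> real" where
  "quantile M p = Inf {x. p \<le> cdf M x}"

definition folded_normal :: "real \<Rightarrow> real measure" where
  "folded_normal t = distr (density lborel (normal_density t 1)) borel (\<lambda>x. \<bar>x\<bar>)"

definition cv :: "real \<Rightarrow> real \<Rightarrow> real" where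
  "cv p t = quantile (folded_normal t) p"

definition FLCI :: "real \<Rightarrow> real \<Rightarrow> real \<Rightarrow> real \<Rightarrow> real set" where
  "FLCI s t \<alpha> v = {v - s * cv (1 - \<alpha>) t .. v + s * cv (1 - \<alpha>) t}"

definition tri :: "real \<Rightarrow> real \<Rightarrow> real" where
  "tri \<alpha> t = q_fun (cv (1 - \<alpha>) t - t) - q_fun (cv (1 - \<alpha>) t + t)"

(* In the following, M is the law of the data under \<theta>, T the estimator of \<theta> x0, and
   s the deterministic scale. *)

definition standardized :: "'d measure \<Rightarrow> ('d \<Rightarrow> real) \<Rightarrow> real \<Rightarrow> 'd \<Rightarrow> real" where
  "standardized M T s \<omega> = (T \<omega> - integral\<^sup>L M T) / s"

definition bias :: "'d measure \<Rightarrow> ('d \<Rightarrow> real) \<Rightarrow> ('x \<Rightarrow> real) \<Rightarrow> 'x \<Rightarrow> real" where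
  "bias M T \<theta> x0 = integral\<^sup>L M T - \<theta> x0"

definition coverage ::
  "'d measure \<Rightarrow> ('d \<Rightarrow> real) \<Rightarrow> real \<Rightarrow> real \<Rightarrow> real \<Rightarrow> ('x \<Rightarrow> real) \<Rightarrow> 'x \<Rightarrow> real" where
  "coverage M T s t \<alpha> \<theta> x0 = measure M {\<omega> \<in> space M. \<theta> x0 \<in> FLCI s t \<alpha> (T \<omega>)}"

(* First-order Edgeworth expansion with coefficient \<kappa> n, common to all \<theta> \<in> \<Theta>.
   The clause on \<kappa> makes the limit of r n z / \<kappa> n meaningful: since x / 0 = 0, the
   remainder would otherwise be unconstrained at every n with \<kappa> n = 0. *)
definition edgeworth_expansion ::
  "('x \<Rightarrow> real) set \<Rightarrow> (nat \<Rightarrow> ('x \<Rightarrow> real) \<Rightarrow> 'd measure) \<Rightarrow> (nat \<Rightarrow> 'd \<Rightarrow> real) \<Rightarrow>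
    (nat \<Rightarrow> real) \<Rightarrow> (nat \<Rightarrow> real) \<Rightarrow> (nat \<Rightarrow> real \<Rightarrow> real) \<Rightarrow> bool" where
  "edgeworth_expansion \<Theta> P T s \<kappa> r \<longleftrightarrow>
     (\<forall>n. s n > 0) \<and>
     (\<forall>n. \<forall>\<theta>\<in>\<Theta>. \<forall>z.
        measure (P n \<theta>) {\<omega> \<in> space (P n \<theta>). standardized (P n \<theta>) (T n) (s n) \<omega> \<le> z} =
          cdf std_normal_distribution z + \<kappa> n / 6 * q_fun z + r n z) \<and>
     (\<forall>\<^sub>F n in sequentially. \<kappa> n \<noteq> 0) \<and>
     (\<forall>z. (\<lambda>n. \<bar>r n z / \<kappa> n\<bar>) \<longlonglongrightarrow> 0)"

(* Together with the expansion above, this says that the expansion also holds, up to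
   o(\<kappa> n), for the probability of a strict inequality. Pointwise control of the remainder
   does not imply it, and the coverage of a closed interval needs it. *)
definition negligible_atoms ::
  "('x \<Rightarrow> real) set \<Rightarrow> (nat \<Rightarrow> ('x \<Rightarrow> real) \<Rightarrow> 'd measure) \<Rightarrow> (nat \<Rightarrow> 'd \<Rightarrow> real) \<Rightarrow>
    (nat \<Rightarrow> real) \<Rightarrow> (nat \<Rightarrow> real) \<Rightarrow> bool" where
  "negligible_atoms \<Theta> P T s \<kappa> \<longleftrightarrow>
     (\<forall>\<theta>\<in>\<Theta>. \<forall>z. (\<lambda>n.
        measure (P n \<theta>) {\<omega> \<in> space (P n \<theta>). standardized (P n \<theta>) (T n) (s n) \<omega> = z} / \<kappa> n)
        \<longlonglongrightarrow> 0)"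

(* \<theta>s may depend on n. *)
definition worst_bias_attained ::
  "('x \<Rightarrow> real) set \<Rightarrow> (nat \<Rightarrow> ('x \<Rightarrow> real) \<Rightarrow> 'd measure) \<Rightarrow> (nat \<Rightarrow> 'd \<Rightarrow> real) \<Rightarrow>
    (nat \<Rightarrow> real) \<Rightarrow> 'x \<Rightarrow> real \<Rightarrow> bool" where
  "worst_bias_attained \<Theta> P T s x0 t \<longleftrightarrow>
     (\<forall>n. \<forall>u\<in>{-1, 1}. \<exists>\<theta>s\<in>\<Theta>. bias (P n \<theta>s) (T n) \<theta>s x0 / s n = u * t)"

end

theory Submission
  imports Defs
begin

text \<open>Write the standardized estimator as \<open>Z\<close> and the standardized bias as \<open>b\<close>. The interval covers
  the target exactly when \<open>\<bar>Z + b\<bar> \<le> c\<close>, where \<open>c\<close> is the critical value, so its coverage is an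
  increment of the distribution function of \<open>Z\<close> plus the atom at the left end point
  (\<open>coverage_eq_increment\<close>). At a worst-case bias \<open>b = u t\<close> with \<open>u = \<plusminus>1\<close>, the three parts
  of the Edgeworth expansion behave as follows. The Gaussian part is exactly \<open>1 - \<alpha>\<close> for either
  sign, because \<open>c\<close> is the \<open>(1 - \<alpha>)\<close>-quantile of \<open>\<bar>N(t,1)\<bar>\<close>, and this law is that of \<open>\<bar>Y + u t\<bar>\<close> for
  standard normal \<open>Y\<close> (\<open>std_normal_increment_cv\<close>). The skewness part is \<open>u \<kappa> \<triangle> / 6\<close>, because
  \<open>q\<close> is even: it is odd in \<open>u\<close> (\<open>q_fun_increment\<close>). The rest is negligible against \<open>\<kappa>\<close>. Hence a bias
  whose sign opposes that of \<open>\<kappa> \<triangle>\<close> loses \<open>\<bar>\<kappa>\<bar> \<bar>\<triangle>\<bar> / 6\<close>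
  of coverage, and if both signs of the worst-case bias are attained, then so is the opposing one.

  The remainder has to be controlled along parameters that vary with \<open>n\<close>, although atoms are
  assumed negligible only for each fixed parameter. This costs nothing: the
  expansion is an identity with the same right-hand side for all parameters, so the law of \<open>Z\<close>
  does not depend on the parameter at all (\<open>edgeworth_atom_eq\<close>).\<close>

section \<open>Quantiles and critical values\<close>

lemma (in real_distribution) cdf_quantile:
  assumes cont: "\<And>x. isCont (cdf M) x" and p: "0 < p" "p < 1"
  shows "cdf M (quantile M p) = p"
proof -
  have "eventually (\<lambda>x. cdf M x < p) at_bot"
    using cdf_lim_at_bot p(1) by (rule order_tendstoD)
  then obtain a where a: "\<And>x. x \<le> a \<Longrightarrow> cdf M x < p"
    by (auto simp: eventually_at_bot_linorder)
  have "eventually (\<lambda>x. p < cdf M x) at_top"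
    using cdf_lim_at_top_prob p(2) by (rule order_tendstoD)
  then obtain b where b: "\<And>x. b \<le> x \<Longrightarrow> p < cdf M x"
    by (auto simp: eventually_at_top_linorder)
  have "a \<le> b"
    using a[of a] b[of a] by (meson linear not_less_iff_gr_or_eq)
  then obtain x where x: "cdf M x = p"
    using IVT[of "cdf M" a p b] a[of a] b[of b] cont by (auto simp: less_imp_le)
  \<comment> \<open>The infimum defining the quantile is attained, so its value is at least \<open>p\<close>; it lies below
    the point \<open>x\<close> where the value is \<open>p\<close>.\<close>
  let ?S = "{y. p \<le> cdf M y}"
  have bdd: "bdd_below ?S"
    unfolding bdd_below_def using a by (metis linear mem_Collect_eq not_less)
  have "closed ?S"
    using cont by (intro closed_Collect_le continuous_on_const continuous_at_imp_continuous_on) auto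
  then have "Inf ?S \<in> ?S"
    using bdd x by (intro closed_contains_Inf) auto
  moreover have "cdf M (Inf ?S) \<le> p"
    using bdd x by (metis (no_types, lifting) cInf_lower cdf_nondecreasing mem_Collect_eq order_refl)
  ultimately show ?thesis
    by (simp add: quantile_def)
qed

lemma (in finite_borel_measure) measure_Icc_eq_cdf:
  assumes "a \<le> b"
  shows "measure M {a..b} = cdf M b - cdf M a + measure M {a}"
proof (cases "a = b")
  case False
  then have "{a..b} = {a<..b} \<union> {a}"
    using assms by auto
  moreover have "measure M ({a<..b} \<union> {a}) = measure M {a<..b} + measure M {a}"
    by (rule finite_measure_Union) (auto simp: M_is_borel)
  ultimately have "measure M {a..b} = measure M {a<..b} + measure M {a}"
    by simp
  then show ?thesis
    using False assms by (simp add: cdf_diff_eq)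
qed simp

lemma std_normal_distribution_finite_null:
  assumes "finite A"
  shows "measure std_normal_distribution A = 0"
proof -
  have "A \<in> null_sets lborel"
    using assms by (rule finite_imp_null_set_lborel)
  then have "A \<in> null_sets std_normal_distribution"
    using absolutely_continuousI_density[of "\<lambda>x. ennreal (std_normal_density x)" lborel]
    by (auto simp: absolutely_continuous_def)
  then show ?thesis
    by (rule measure_eq_0_null_sets)
qed

text \<open>Both signs of the shift are allowed because the standard normal law is symmetric; this is why
  one critical value serves a bias of either sign.\<close>

lemma folded_normal_eq_distr_std_normal:
  fixes u t :: real
  assumes u: "u \<in> {-1, 1}"
  shows "folded_normal t = distr std_normal_distribution borel (\<lambda>y. \<bar>y + u * t\<bar>)"
proof -
  interpret std: real_distribution std_normal_distribution
    by (rule real_dist_normal_dist)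
  have "distributed std_normal_distribution lborel (\<lambda>y. y) std_normal_density"
    by (auto simp: distributed_def distr_id2)
  from std.normal_density_affine[OF this, of u t]
  have "distributed std_normal_distribution lborel (\<lambda>y. t + u * y) (normal_density t 1)"
    using u by auto
  then have "density lborel (normal_density t 1) =
      distr std_normal_distribution borel (\<lambda>y. t + u * y)"
    by (metis distributed_distr_eq_density distr_cong sets_lborel)
  then have "folded_normal t = distr std_normal_distribution borel (\<lambda>y. \<bar>t + u * y\<bar>)"
    by (simp add: folded_normal_def distr_distr comp_def)
  also have "(\<lambda>y. \<bar>t + u * y\<bar>) = (\<lambda>y. \<bar>y + u * t\<bar>)"
    using u by (auto simp: abs_if)
  finally show ?thesis .
qed

lemma real_distribution_folded_normal: "real_distribution (folded_normal t)"
proof -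
  interpret std: real_distribution std_normal_distribution
    by (rule real_dist_normal_dist)
  show ?thesis
    unfolding folded_normal_eq_distr_std_normal[of 1 t, simplified] by simp
qed

lemma cdf_folded_normal_cv:
  assumes "0 < \<alpha>" "\<alpha> < 1"
  shows "cdf (folded_normal t) (cv (1 - \<alpha>) t) = 1 - \<alpha>"
proof -
  interpret real_distribution "folded_normal t"
    by (rule real_distribution_folded_normal)
  \<comment> \<open>The fibres of \<open>y \<mapsto> \<bar>y + t\<bar>\<close> are finite, so the folded law has no atoms.\<close>
  have "isCont (cdf (folded_normal t)) x" for x
  proof -
    have "(\<lambda>y. \<bar>y + t\<bar>) -` {x} \<subseteq> {x - t, - x - t}"
      by (auto simp: abs_if split: if_splits)
    then have "finite ((\<lambda>y. \<bar>y + t\<bar>) -` {x})"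
      by (rule finite_subset) simp
    then have "measure (folded_normal t) {x} = 0"
      unfolding folded_normal_eq_distr_std_normal[of 1 t, simplified]
      by (simp add: measure_distr std_normal_distribution_finite_null)
    then show ?thesis
      by (simp add: isCont_cdf)
  qed
  then show ?thesis
    unfolding cv_def using assms by (intro cdf_quantile) auto
qed

lemma cv_nonneg:
  assumes "0 < \<alpha>" "\<alpha> < 1"
  shows "0 \<le> cv (1 - \<alpha>) t"
proof (rule ccontr)
  assume neg: "\<not> 0 \<le> cv (1 - \<alpha>) t"
  then have "(\<lambda>y. \<bar>y + t\<bar>) -` {..cv (1 - \<alpha>) t} = {}"
    by auto
  then have "cdf (folded_normal t) (cv (1 - \<alpha>) t) = 0"
    unfolding folded_normal_eq_distr_std_normal[of 1 t, simplified] cdf_def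
    by (simp add: measure_distr)
  then show False
    using cdf_folded_normal_cv[OF assms, of t] assms by simp
qed

lemma std_normal_increment_cv:
  fixes u t \<alpha> :: real
  assumes \<alpha>: "0 < \<alpha>" "\<alpha> < 1" and u: "u \<in> {-1, 1}"
  defines "c \<equiv> cv (1 - \<alpha>) t"
  shows "cdf std_normal_distribution (c - u * t) - cdf std_normal_distribution (- c - u * t) = 1 - \<alpha>"
proof -
  interpret std: real_distribution std_normal_distribution
    by (rule real_dist_normal_dist)
  have "1 - \<alpha> = cdf (folded_normal t) c"
    using cdf_folded_normal_cv[OF \<alpha>] by (simp add: c_def)
  also have "\<dots> = measure std_normal_distribution ((\<lambda>y. \<bar>y + u * t\<bar>) -` {..c})"
    unfolding folded_normal_eq_distr_std_normal[OF u] cdf_def by (simp add: measure_distr)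
  also have "(\<lambda>y. \<bar>y + u * t\<bar>) -` {..c} = {- c - u * t..c - u * t}"
    by (auto simp: abs_le_iff)
  finally show ?thesis
    using cv_nonneg[OF \<alpha>, of t]
    by (simp add: std.measure_Icc_eq_cdf std_normal_distribution_finite_null c_def)
qed

text \<open>By evenness of \<open>q\<close>, flipping the sign of the bias exchanges the two terms of \<open>tri\<close>.\<close>

lemma q_fun_increment:
  fixes u t \<alpha> :: real
  assumes u: "u \<in> {-1, 1}"
  defines "c \<equiv> cv (1 - \<alpha>) t"
  shows "q_fun (c - u * t) - q_fun (- c - u * t) = u * tri \<alpha> t"
proof -
  have even: "q_fun (- z) = q_fun z" for z
    by (simp add: q_fun_def normal_density_def)
  show ?thesis
    using u even[of "c + t"] even[of "c - t"] by (auto simp: tri_def c_def)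
qed

section \<open>Coverage and the law of the standardized estimator\<close>

lemma standardized_measurable:
  assumes [measurable]: "T \<in> borel_measurable M"
  shows "standardized M T s \<in> borel_measurable M"
  unfolding standardized_def[abs_def] by measurable

lemma coverage_eq_increment:
  fixes b t :: real
  assumes M: "prob_space M" and T: "T \<in> borel_measurable M" and s: "s > 0"
    and \<alpha>: "0 < \<alpha>" "\<alpha> < 1" and b: "bias M T \<theta> x0 / s = b"
  defines "c \<equiv> cv (1 - \<alpha>) t"
    and "F \<equiv> \<lambda>z. measure M {\<omega> \<in> space M. standardized M T s \<omega> \<le> z}"
  shows "coverage M T s t \<alpha> \<theta> x0 =
    F (c - b) - F (- c - b) + measure M {\<omega> \<in> space M. standardized M T s \<omega> = - c - b}"
proof -
  interpret prob_space M
    by (rule M)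
  define D where "D = distr M borel (standardized M T s)"
  have meas: "standardized M T s \<in> borel_measurable M"
    using T by (rule standardized_measurable)
  interpret D: real_distribution D
    unfolding D_def using meas by (rule real_distribution_distr)
  have D: "measure D A = measure M {\<omega> \<in> space M. standardized M T s \<omega> \<in> A}"
    if "A \<in> sets borel" for A
    using that meas by (auto simp: D_def measure_distr intro!: arg_cong[where f = "measure M"])
  have target: "\<theta> x0 = integral\<^sup>L M T - s * b"
    using b s by (auto simp: bias_def field_simps)
  have "\<theta> x0 \<in> FLCI s t \<alpha> (T \<omega>) \<longleftrightarrow> standardized M T s \<omega> \<in> {- c - b..c - b}" for \<omega>
    using s unfolding target FLCI_def standardized_def c_def
    by (auto simp: field_simps)
  then have "coverage M T s t \<alpha> \<theta> x0 = measure D {- c - b..c - b}"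
    by (simp add: coverage_def D)
  also have "\<dots> = cdf D (c - b) - cdf D (- c - b) + measure D {- c - b}"
    using cv_nonneg[OF \<alpha>, of t] by (intro D.measure_Icc_eq_cdf) (simp add: c_def)
  finally show ?thesis
    by (simp add: F_def cdf_def D)
qed

text \<open>A distribution function determines its law, so a common distribution function forces common
  atoms. This turns the negligibility of atoms at one parameter into a bound uniform over all.\<close>

lemma edgeworth_atom_eq:
  assumes A1: "edgeworth_expansion \<Theta> P T s \<kappa> r"
    and P: "\<And>\<theta>. \<theta> \<in> \<Theta> \<Longrightarrow> prob_space (P n \<theta>)"
    and T: "\<And>\<theta>. \<theta> \<in> \<Theta> \<Longrightarrow> T n \<in> borel_measurable (P n \<theta>)"
    and \<theta>: "\<theta> \<in> \<Theta>" "\<theta>' \<in> \<Theta>"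
  shows "measure (P n \<theta>) {\<omega> \<in> space (P n \<theta>). standardized (P n \<theta>) (T n) (s n) \<omega> = z} =
    measure (P n \<theta>') {\<omega> \<in> space (P n \<theta>'). standardized (P n \<theta>') (T n) (s n) \<omega> = z}"
proof -
  define D where "D \<theta> = distr (P n \<theta>) borel (standardized (P n \<theta>) (T n) (s n))" for \<theta>
  have real_D: "real_distribution (D \<theta>)" if "\<theta> \<in> \<Theta>" for \<theta>
    unfolding D_def using P[OF that] T[OF that]
    by (intro prob_space.real_distribution_distr standardized_measurable)
  have D: "measure (D \<theta>) A =
      measure (P n \<theta>) {\<omega> \<in> space (P n \<theta>). standardized (P n \<theta>) (T n) (s n) \<omega> \<in> A}"
    if "\<theta> \<in> \<Theta>" "A \<in> sets borel" for \<theta> A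
    using standardized_measurable[OF T[OF that(1)]] that(2)
    by (auto simp: D_def measure_distr intro!: arg_cong[where f = "measure (P n \<theta>)"])
  have "cdf (D \<theta>) = cdf (D \<theta>')"
    using A1 \<theta> by (intro ext) (simp add: cdf_def D edgeworth_expansion_def)
  then have "D \<theta> = D \<theta>'"
    using real_D \<theta> by (intro cdf_unique)
  then have "measure (D \<theta>) {z} = measure (D \<theta>') {z}"
    by simp
  then show ?thesis
    using \<theta> by (simp add: D)
qed

text \<open>The expansion of the coverage at a worst-case bias. The remainder is produced before the parameter
  is chosen, so it may be used along any sequence of parameters.\<close>

lemma coverage_expansion_worst_bias:
  fixes u t :: real
  assumes P: "\<And>n \<theta>. \<theta> \<in> \<Theta> \<Longrightarrow> prob_space (P n \<theta>)"
    and T: "\<And>n \<theta>. \<theta> \<in> \<Theta> \<Longrightarrow> T n \<in> borel_measurable (P n \<theta>)"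
    and A1: "edgeworth_expansion \<Theta> P T s \<kappa> r"
    and atoms: "negligible_atoms \<Theta> P T s \<kappa>"
    and \<alpha>: "0 < \<alpha>" "\<alpha> < 1" and u: "u \<in> {-1, 1}"
  obtains E where "E \<in> o(\<lambda>n. \<bar>\<kappa> n\<bar>)"
    and "\<And>n \<theta>. \<theta> \<in> \<Theta> \<Longrightarrow> bias (P n \<theta>) (T n) \<theta> x0 / s n = u * t \<Longrightarrow>
      coverage (P n \<theta>) (T n) (s n) t \<alpha> \<theta> x0 = 1 - \<alpha> + \<kappa> n / 6 * (u * tri \<alpha> t) + E n"
proof (cases "\<Theta> = {}")
  case True
  show ?thesis
    using that[of "\<lambda>_. 0"] True by simp
next
  case False
  \<comment> \<open>All parameters share the atoms of this one, so it can stand for all of them.\<close>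
  then obtain \<theta>' where \<theta>': "\<theta>' \<in> \<Theta>"
    by blast
  define c where "c = cv (1 - \<alpha>) t"
  define atom where "atom n \<theta> =
    measure (P n \<theta>) {\<omega> \<in> space (P n \<theta>). standardized (P n \<theta>) (T n) (s n) \<omega> = - c - u * t}" for n \<theta>
  define E where "E n = r n (c - u * t) - r n (- c - u * t) + atom n \<theta>'" for n
  have s: "s n > 0" and F: "\<theta> \<in> \<Theta> \<Longrightarrow>
      measure (P n \<theta>) {\<omega> \<in> space (P n \<theta>). standardized (P n \<theta>) (T n) (s n) \<omega> \<le> z} =
        cdf std_normal_distribution z + \<kappa> n / 6 * q_fun z + r n z" for n \<theta> z
    using A1 by (auto simp: edgeworth_expansion_def)
  have \<kappa>: "\<forall>\<^sub>F n in sequentially. \<kappa> n \<noteq> 0"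
    using A1 by (simp add: edgeworth_expansion_def)
  have r: "(\<lambda>n. r n z) \<in> o(\<kappa>)" for z
    using A1 \<kappa> by (intro smalloI_tendsto)
      (auto simp: edgeworth_expansion_def intro: tendsto_rabs_zero_cancel)
  have "(\<lambda>n. atom n \<theta>') \<in> o(\<kappa>)"
    using atoms \<kappa> \<theta>' by (intro smalloI_tendsto) (auto simp: negligible_atoms_def atom_def)
  then have E: "E \<in> o(\<lambda>n. \<bar>\<kappa> n\<bar>)"
    unfolding E_def using r by (simp add: sum_in_smallo)
  have "coverage (P n \<theta>) (T n) (s n) t \<alpha> \<theta> x0 = 1 - \<alpha> + \<kappa> n / 6 * (u * tri \<alpha> t) + E n"
    if \<theta>: "\<theta> \<in> \<Theta>" and b: "bias (P n \<theta>) (T n) \<theta> x0 / s n = u * t" for n \<theta>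
  proof -
    let ?\<Phi> = "cdf std_normal_distribution"
    have "coverage (P n \<theta>) (T n) (s n) t \<alpha> \<theta> x0 =
        (?\<Phi> (c - u * t) + \<kappa> n / 6 * q_fun (c - u * t) + r n (c - u * t))
        - (?\<Phi> (- c - u * t) + \<kappa> n / 6 * q_fun (- c - u * t) + r n (- c - u * t)) + atom n \<theta>"
      unfolding coverage_eq_increment[OF P[OF \<theta>] T[OF \<theta>] s \<alpha> b, of t] F[OF \<theta>] c_def atom_def ..
    also have "atom n \<theta> = atom n \<theta>'"
      unfolding atom_def by (rule edgeworth_atom_eq[OF A1 P T \<theta> \<theta>'])
    finally have "coverage (P n \<theta>) (T n) (s n) t \<alpha> \<theta> x0 =
        (?\<Phi> (c - u * t) - ?\<Phi> (- c - u * t))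
        + \<kappa> n / 6 * (q_fun (c - u * t) - q_fun (- c - u * t)) + E n"
      by (simp add: E_def right_diff_distrib)
    then show ?thesis
      using std_normal_increment_cv[OF \<alpha> u, of t] q_fun_increment[OF u, of \<alpha> t] by (simp add: c_def)
  qed
  with E show ?thesis
    by (rule that)
qed

section \<open>Undercoverage\<close>

theorem proposition5:
  fixes \<Theta> :: "('x \<Rightarrow> real) set" and x0 :: 'x
    and P :: "nat \<Rightarrow> ('x \<Rightarrow> real) \<Rightarrow> 'd measure"
    and est :: "'h \<Rightarrow> nat \<Rightarrow> 'd \<Rightarrow> real" and h :: 'h
    and \<sigma> :: "'h \<Rightarrow> nat \<Rightarrow> real" and \<kappa> :: "nat \<Rightarrow> real"
    and r :: "nat \<Rightarrow> real \<Rightarrow> real" and t \<alpha> :: real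
  assumes "\<And>n \<theta>. \<theta> \<in> \<Theta> \<Longrightarrow> prob_space (P n \<theta>)"
    and "\<And>n \<theta>. \<theta> \<in> \<Theta> \<Longrightarrow> integrable (P n \<theta>) (est h n)"
    and A1: "edgeworth_expansion \<Theta> P (est h) (\<sigma> h) \<kappa> r"
    and atoms: "negligible_atoms \<Theta> P (est h) (\<sigma> h) \<kappa>"
    and "\<And>n. bdd_above ((\<lambda>\<theta>. \<bar>bias (P n \<theta>) (est h n) \<theta> x0 / \<sigma> h n\<bar>) ` \<Theta>)"
    and "\<And>n. t = (SUP \<theta>\<in>\<Theta>. \<bar>bias (P n \<theta>) (est h n) \<theta> x0 / \<sigma> h n\<bar>)"
    and "0 < \<alpha>" "\<alpha> < 1"
  shows "(worst_bias_attained \<Theta> P (est h) (\<sigma> h) x0 t \<longrightarrow>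
           (\<exists>\<rho> \<in> o(\<lambda>n. \<bar>\<kappa> n\<bar>). \<forall>n.
              (INF \<theta>\<in>\<Theta>. coverage (P n \<theta>) (est h n) (\<sigma> h n) t \<alpha> \<theta> x0)
                \<le> 1 - \<alpha> - \<bar>\<kappa> n\<bar> / 6 * \<bar>tri \<alpha> t\<bar> + \<rho> n)) \<and>
         (\<forall>\<theta>0 :: nat \<Rightarrow> 'x \<Rightarrow> real. (\<forall>n. \<theta>0 n \<in> \<Theta>) \<longrightarrow>
           (\<exists>\<rho> \<in> o(\<lambda>n. \<bar>\<kappa> n\<bar>). \<forall>n.
              \<bar>bias (P n (\<theta>0 n)) (est h n) (\<theta>0 n) x0 / \<sigma> h n\<bar> = t \<longrightarrow>
              sgn (bias (P n (\<theta>0 n)) (est h n) (\<theta>0 n) x0 / \<sigma> h n) * \<kappa> n * tri \<alpha> t < 0 \<longrightarrow>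
              coverage (P n (\<theta>0 n)) (est h n) (\<sigma> h n) t \<alpha> (\<theta>0 n) x0
                \<le> 1 - \<alpha> - \<bar>\<kappa> n\<bar> / 6 * \<bar>tri \<alpha> t\<bar> + \<rho> n))"
proof -
  have meas: "\<And>n \<theta>. \<theta> \<in> \<Theta> \<Longrightarrow> est h n \<in> borel_measurable (P n \<theta>)"
    using assms(2) by (rule borel_measurable_integrable)
  note expansion = coverage_expansion_worst_bias[of \<Theta> P "est h" "\<sigma> h" \<kappa> r \<alpha> _ x0 t,
      OF assms(1) meas A1 atoms assms(7,8)]
  obtain E1 where E1: "E1 \<in> o(\<lambda>n. \<bar>\<kappa> n\<bar>)"
    and cov1: "\<And>n \<theta>. \<theta> \<in> \<Theta> \<Longrightarrow> bias (P n \<theta>) (est h n) \<theta> x0 / \<sigma> h n = 1 * t \<Longrightarrow>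
      coverage (P n \<theta>) (est h n) (\<sigma> h n) t \<alpha> \<theta> x0 = 1 - \<alpha> + \<kappa> n / 6 * (1 * tri \<alpha> t) + E1 n"
    using expansion[of 1] by blast
  obtain E2 where E2: "E2 \<in> o(\<lambda>n. \<bar>\<kappa> n\<bar>)"
    and cov2: "\<And>n \<theta>. \<theta> \<in> \<Theta> \<Longrightarrow> bias (P n \<theta>) (est h n) \<theta> x0 / \<sigma> h n = -1 * t \<Longrightarrow>
      coverage (P n \<theta>) (est h n) (\<sigma> h n) t \<alpha> \<theta> x0 = 1 - \<alpha> + \<kappa> n / 6 * (-1 * tri \<alpha> t) + E2 n"
    using expansion[of "-1"] by blast
  \<comment> \<open>The sign of the bias may change with \<open>n\<close>, so one bound has to serve both signs.\<close>
  define \<rho> where "\<rho> n = \<bar>E1 n\<bar> + \<bar>E2 n\<bar>" for n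
  have \<rho>: "\<rho> \<in> o(\<lambda>n. \<bar>\<kappa> n\<bar>)"
    unfolding \<rho>_def using E1 E2 by (intro sum_in_smallo) auto
  have loss: "coverage (P n \<theta>) (est h n) (\<sigma> h n) t \<alpha> \<theta> x0 \<le> 1 - \<alpha> - \<bar>\<kappa> n\<bar> / 6 * \<bar>tri \<alpha> t\<bar> + \<rho> n"
    if \<theta>: "\<theta> \<in> \<Theta>" and u: "u \<in> {-1, 1}"
      and b: "bias (P n \<theta>) (est h n) \<theta> x0 / \<sigma> h n = u * t"
      and opp: "u * (\<kappa> n * tri \<alpha> t) \<le> 0" for n \<theta> u
  proof -
    have "u * (\<kappa> n * tri \<alpha> t) = - (\<bar>\<kappa> n\<bar> * \<bar>tri \<alpha> t\<bar>)"
      using u opp unfolding abs_mult[symmetric] by auto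
    moreover have "coverage (P n \<theta>) (est h n) (\<sigma> h n) t \<alpha> \<theta> x0
        \<le> 1 - \<alpha> + u * (\<kappa> n * tri \<alpha> t) / 6 + \<rho> n"
      using u b cov1[OF \<theta>, of n] cov2[OF \<theta>, of n] by (auto simp: \<rho>_def)
    ultimately show ?thesis
      by simp
  qed
  show ?thesis
  proof (intro conjI impI allI bexI[of _ \<rho>] \<rho>)
    fix n
    assume attained: "worst_bias_attained \<Theta> P (est h) (\<sigma> h) x0 t"
    define u :: real where "u = (if \<kappa> n * tri \<alpha> t \<le> 0 then 1 else -1)"
    then have "u \<in> {-1, 1}"
      by simp
    then obtain \<theta> where \<theta>: "\<theta> \<in> \<Theta>" "bias (P n \<theta>) (est h n) \<theta> x0 / \<sigma> h n = u * t"
      using attained unfolding worst_bias_attained_def by blast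
    have "(INF \<theta>\<in>\<Theta>. coverage (P n \<theta>) (est h n) (\<sigma> h n) t \<alpha> \<theta> x0)
        \<le> coverage (P n \<theta>) (est h n) (\<sigma> h n) t \<alpha> \<theta> x0"
      using \<theta>(1) by (intro cINF_lower bdd_belowI[of _ 0]) (auto simp: coverage_def)
    also have "\<dots> \<le> 1 - \<alpha> - \<bar>\<kappa> n\<bar> / 6 * \<bar>tri \<alpha> t\<bar> + \<rho> n"
      using \<theta> by (intro loss[of _ u]) (auto simp: u_def)
    finally show "(INF \<theta>\<in>\<Theta>. coverage (P n \<theta>) (est h n) (\<sigma> h n) t \<alpha> \<theta> x0)
        \<le> 1 - \<alpha> - \<bar>\<kappa> n\<bar> / 6 * \<bar>tri \<alpha> t\<bar> + \<rho> n" .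
  next
    fix \<theta>0 :: "nat \<Rightarrow> 'x \<Rightarrow> real" and n
    define b where "b = bias (P n (\<theta>0 n)) (est h n) (\<theta>0 n) x0 / \<sigma> h n"
    assume \<theta>0: "\<forall>n. \<theta>0 n \<in> \<Theta>"
      and "\<bar>bias (P n (\<theta>0 n)) (est h n) (\<theta>0 n) x0 / \<sigma> h n\<bar> = t"
      and "sgn (bias (P n (\<theta>0 n)) (est h n) (\<theta>0 n) x0 / \<sigma> h n) * \<kappa> n * tri \<alpha> t < 0"
    then have t: "\<bar>b\<bar> = t" and opp: "sgn b * \<kappa> n * tri \<alpha> t < 0"
      by (simp_all only: b_def)
    have u: "sgn b \<in> {-1, 1}"
      using opp by (cases b "0 :: real" rule: linorder_cases) auto
    have b: "bias (P n (\<theta>0 n)) (est h n) (\<theta>0 n) x0 / \<sigma> h n = sgn b * t"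
      unfolding t[symmetric] sgn_mult_abs by (simp only: b_def)
    have "sgn b * (\<kappa> n * tri \<alpha> t) \<le> 0"
      using opp by (simp add: mult.assoc)
    then show "coverage (P n (\<theta>0 n)) (est h n) (\<sigma> h n) t \<alpha> (\<theta>0 n) x0
        \<le> 1 - \<alpha> - \<bar>\<kappa> n\<bar> / 6 * \<bar>tri \<alpha> t\<bar> + \<rho> n"
      using loss[OF spec[OF \<theta>0] u b] by blast
  qed
qed

end
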